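(* Let $H$ be a Hopf algebra over a field $\Bbbk$, let $\mathcal{B}=G(H)\sqcup\mathcal{B}'$ be a basis of $H$ (extending the set $G(H)$ of group-like elements), and let $\lambda: H\to\Bbbk$ be a linear map. Then $\lambda$ is a partial action of $H$ on $\Bbbk$ if and only if $N=\{g\in G(H)\mid \lambda(g)=1_\Bbbk\}$ is a subgroup of $G(H)$ and $(\lambda(b))_{b\in\mathcal{B}}$ is both an initial $N$-condition for the partial system associated with $\mathcal{B}$ and a solution of the $N$-reduced partial system associated with $\mathcal{B}$.
   Context: Sweedler notation $\Delta(h)=h_1\otimes h_2$ is used. A partial action of a Hopf algebra $H$ on its base field $\Bbbk$ is a linear map $\lambda: H\to\Bbbk$ such that $\lambda(1_H)=1_\Bbbk$ and $\lambda(h)\lambda(k)=\lambda(h_1)\lambda(h_2k)$ for all $h,k\in H$. $G(H)$ is the group of group-like elements of $H$, and for $t,s\in G(H)$, $P_{t,s}(H)=\{x\in H\mid \Delta(x)=x\otimes t+s\otimes x\}$. Let $\mathcal{B}=G(H)\sqcup\mathcal{B}'$ be a basis of $H$ and let $\Lambda: H\to\Bbbk[X_b\mid b\in\mathcal{B}]$ be the linear map with $\Lambda(b)=X_b$; the equations below are polynomial equations in the unknowns $X_b$, and a family $(\alpha_b)_{b\in\mathcal{B}}$ of elements of $\Bbbk$ is a solution if the equations hold after substituting $X_b=\alpha_b$. The partial system associated with $\mathcal{B}$ is the system $\Lambda(1_H)=1_\Bbbk$, $\Lambda(a)\Lambda(b)=\Lambda(a_1)\Lambda(a_2b)$ for $a,b\in\mathcal{B}$.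 Fix a subgroup $N$ of $G(H)$. An initial $N$-condition for the partial system associated with $\mathcal{B}$ is a solution $(\alpha_b)_{b\in\mathcal{B}}$ of the system $$\Lambda(g)=1_\Bbbk,\quad \Lambda(h)=0,\quad \Lambda(u)=\Lambda(gu)\qquad (g\in N,\ h\in G(H)\setminus N,\ u\in\mathcal{B}').$$ On $\mathcal{B}'$ consider the equivalence relation $x\sim_N y$ iff $y=gx$ for some $g\in N$, and let $\widetilde{N}\subseteq\mathcal{B}'$ be a transversal set for $\sim_N$ (exactly one representative of each class). For $t,s\in G(H)$, let $\mathcal{B}_{t,s}=\{x\in P_{t,s}(H)\mid t\in N,\ s\in G(H)\setminus N\}$ (empty unless $t\in N$ and $s\notin N$), and $\widetilde{\mathcal{B}}=\widetilde{N}\setminus\bigcup_{t,s\in G(H)}\mathcal{B}_{t,s}$. The $N$-reduced partial system associated with $\mathcal{B}$ is the system $$\Lambda(u)\Lambda(v)=\Lambda(u_1)\Lambda(u_2v)\qquad (u\in\widetilde{\mathcal{B}},\ v\in\mathcal{B}).$$ *)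

theory Defs
  imports Complex_Main "HOL-Library.Poly_Mapping" "HOL-Algebra.Group"
begin

section \<open>Tensor powers of a vector space\<close>

text \<open>
  \<open>H \<otimes> H\<close> and \<open>H \<otimes> H \<otimes> H\<close> are constructed as quotients of the free vector space on
  pairs (triples) of vectors, by the span of the multilinearity relators. Tensors are thus cosets,
  and equality of tensors is equality of sets. The map \<open>sc\<close> is the scalar multiplication of \<open>H\<close>.
\<close>

definition free_span :: "('x \<Rightarrow>\<^sub>0 'k::field) set \<Rightarrow> ('x \<Rightarrow>\<^sub>0 'k) set" where
  "free_span = module.span (\<lambda>c. Poly_Mapping.map (\<lambda>d. c * d))"

definition free_quot :: "('x \<Rightarrow>\<^sub>0 'k::field) set \<Rightarrow> (('x \<Rightarrow>\<^sub>0 'k) \<times> ('x \<Rightarrow>\<^sub>0 'k)) set" where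
  "free_quot R = {(p, q). p - q \<in> free_span R}"

definition relators2 ::
  "('k::field \<Rightarrow> 'a::ab_group_add \<Rightarrow> 'a) \<Rightarrow> ('a \<times> 'a \<Rightarrow>\<^sub>0 'k) set" where
  "relators2 sc =
     (\<Union>x x' y. {Poly_Mapping.single (x + x', y) 1
                   - (Poly_Mapping.single (x, y) 1 + Poly_Mapping.single (x', y) 1)}) \<union>
     (\<Union>x y y'. {Poly_Mapping.single (x, y + y') 1
                   - (Poly_Mapping.single (x, y) 1 + Poly_Mapping.single (x, y') 1)}) \<union>
     (\<Union>c x y. {Poly_Mapping.single (sc c x, y) 1 - Poly_Mapping.single (x, y) c}) \<union>
     (\<Union>c x y. {Poly_Mapping.single (x, sc c y) 1 - Poly_Mapping.single (x, y) c})"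

definition relators3 ::
  "('k::field \<Rightarrow> 'a::ab_group_add \<Rightarrow> 'a) \<Rightarrow> ('a \<times> 'a \<times> 'a \<Rightarrow>\<^sub>0 'k) set" where
  "relators3 sc =
     (\<Union>x x' y z. {Poly_Mapping.single (x + x', y, z) 1
                   - (Poly_Mapping.single (x, y, z) 1 + Poly_Mapping.single (x', y, z) 1)}) \<union>
     (\<Union>x y y' z. {Poly_Mapping.single (x, y + y', z) 1
                   - (Poly_Mapping.single (x, y, z) 1 + Poly_Mapping.single (x, y', z) 1)}) \<union>
     (\<Union>x y z z'. {Poly_Mapping.single (x, y, z + z') 1
                   - (Poly_Mapping.single (x, y, z) 1 + Poly_Mapping.single (x, y, z') 1)}) \<union>
     (\<Union>c x y z. {Poly_Mapping.single (sc c x, y, z) 1 - Poly_Mapping.single (x, y, z) c}) \<union>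
     (\<Union>c x y z. {Poly_Mapping.single (x, sc c y, z) 1 - Poly_Mapping.single (x, y, z) c}) \<union>
     (\<Union>c x y z. {Poly_Mapping.single (x, y, sc c z) 1 - Poly_Mapping.single (x, y, z) c})"

definition formal_sum :: "'x list \<Rightarrow> ('x \<Rightarrow>\<^sub>0 'k::field)" where
  "formal_sum xs = (\<Sum>x\<leftarrow>xs. Poly_Mapping.single x 1)"

definition tensor_square ::
  "('k::field \<Rightarrow> 'a::ab_group_add \<Rightarrow> 'a) \<Rightarrow> ('a \<times> 'a \<Rightarrow>\<^sub>0 'k) set set" where
  "tensor_square sc = UNIV // free_quot (relators2 sc)"

text \<open>
  \<open>tensor2 sc [(x\<^sub>1, y\<^sub>1), \<dots>, (x\<^sub>n, y\<^sub>n)]\<close> is the tensor \<open>x\<^sub>1 \<otimes> y\<^sub>1 + \<dots> + x\<^sub>n \<otimes> y\<^sub>n\<close>; scalars can be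
  absorbed into the vectors, so every tensor is of this form.
\<close>

definition tensor2 ::
  "('k::field \<Rightarrow> 'a::ab_group_add \<Rightarrow> 'a) \<Rightarrow> ('a \<times> 'a) list \<Rightarrow> ('a \<times> 'a \<Rightarrow>\<^sub>0 'k) set" where
  "tensor2 sc xs = free_quot (relators2 sc) `` {formal_sum xs}"

definition tensor3 ::
  "('k::field \<Rightarrow> 'a::ab_group_add \<Rightarrow> 'a) \<Rightarrow> ('a \<times> 'a \<times> 'a) list
    \<Rightarrow> ('a \<times> 'a \<times> 'a \<Rightarrow>\<^sub>0 'k) set" where
  "tensor3 sc xs = free_quot (relators3 sc) `` {formal_sum xs}"

text \<open>
  Sweedler notation: \<open>(h\<^sub>1, h\<^sub>2) \<leftarrow> sweedler sc (\<Delta> h)\<close> ranges over the terms of a chosen expression of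
  \<open>\<Delta> h\<close> as a sum of simple tensors. It is only used inside expressions that are bilinear in
  \<open>(h\<^sub>1, h\<^sub>2)\<close>, whose sum does not depend on the choice.
\<close>

definition sweedler ::
  "('k::field \<Rightarrow> 'a::ab_group_add \<Rightarrow> 'a) \<Rightarrow> ('a \<times> 'a \<Rightarrow>\<^sub>0 'k) set \<Rightarrow> ('a \<times> 'a) list" where
  "sweedler sc T = (SOME xs. tensor2 sc xs = T)"


section \<open>Hopf algebras\<close>

text \<open>
  The type class \<open>ring_1\<close> excludes only the zero ring, which is not a Hopf algebra over a field
  because \<open>\<epsilon> 1 = 1\<close>.
\<close>

locale hopf_algebra = vector_space sc
  for sc :: "'k::field \<Rightarrow> 'a::ring_1 \<Rightarrow> 'a" +
  fixes \<Delta> :: "'a \<Rightarrow> ('a \<times> 'a \<Rightarrow>\<^sub>0 'k) set"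
    and \<epsilon> :: "'a \<Rightarrow> 'k"
    and S :: "'a \<Rightarrow> 'a"
  assumes sc_mult_left: "sc c x * y = sc c (x * y)"
    and sc_mult_right: "x * sc c y = sc c (x * y)"
    and comult_tensor: "\<Delta> h \<in> tensor_square sc"
    and comult_add: "\<Delta> (h + k) = tensor2 sc (sweedler sc (\<Delta> h) @ sweedler sc (\<Delta> k))"
    and comult_sc: "\<Delta> (sc c h) = tensor2 sc [(sc c h\<^sub>1, h\<^sub>2). (h\<^sub>1, h\<^sub>2) \<leftarrow> sweedler sc (\<Delta> h)]"
    and counit_linear: "Vector_Spaces.linear sc (*) \<epsilon>"
    and antipode_linear: "Vector_Spaces.linear sc sc S"
    and coassoc:
      "tensor3 sc [(h\<^sub>1\<^sub>1, h\<^sub>1\<^sub>2, h\<^sub>2). (h\<^sub>1, h\<^sub>2) \<leftarrow> sweedler sc (\<Delta> h), (h\<^sub>1\<^sub>1, h\<^sub>1\<^sub>2) \<leftarrow> sweedler sc (\<Delta> h\<^sub>1)]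
       = tensor3 sc [(h\<^sub>1, h\<^sub>2\<^sub>1, h\<^sub>2\<^sub>2). (h\<^sub>1, h\<^sub>2) \<leftarrow> sweedler sc (\<Delta> h), (h\<^sub>2\<^sub>1, h\<^sub>2\<^sub>2) \<leftarrow> sweedler sc (\<Delta> h\<^sub>2)]"
    and counit_left: "(\<Sum>(h\<^sub>1, h\<^sub>2)\<leftarrow>sweedler sc (\<Delta> h). sc (\<epsilon> h\<^sub>1) h\<^sub>2) = h"
    and counit_right: "(\<Sum>(h\<^sub>1, h\<^sub>2)\<leftarrow>sweedler sc (\<Delta> h). sc (\<epsilon> h\<^sub>2) h\<^sub>1) = h"
    and comult_one: "\<Delta> 1 = tensor2 sc [(1, 1)]"
    and comult_mult:
      "\<Delta> (h * k) = tensor2 sc [(h\<^sub>1 * k\<^sub>1, h\<^sub>2 * k\<^sub>2).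
                         (h\<^sub>1, h\<^sub>2) \<leftarrow> sweedler sc (\<Delta> h), (k\<^sub>1, k\<^sub>2) \<leftarrow> sweedler sc (\<Delta> k)]"
    and counit_one: "\<epsilon> 1 = 1"
    and counit_mult: "\<epsilon> (h * k) = \<epsilon> h * \<epsilon> k"
    and antipode_left: "(\<Sum>(h\<^sub>1, h\<^sub>2)\<leftarrow>sweedler sc (\<Delta> h). S h\<^sub>1 * h\<^sub>2) = sc (\<epsilon> h) 1"
    and antipode_right: "(\<Sum>(h\<^sub>1, h\<^sub>2)\<leftarrow>sweedler sc (\<Delta> h). h\<^sub>1 * S h\<^sub>2) = sc (\<epsilon> h) 1"

definition grouplikes ::
  "('k::field \<Rightarrow> 'a::ring_1 \<Rightarrow> 'a) \<Rightarrow> ('a \<Rightarrow> ('a \<times> 'a \<Rightarrow>\<^sub>0 'k) set) \<Rightarrow> 'a set" where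
  "grouplikes sc \<Delta> = {g. g \<noteq> 0 \<and> \<Delta> g = tensor2 sc [(g, g)]}"

definition grouplike_group ::
  "('k::field \<Rightarrow> 'a::ring_1 \<Rightarrow> 'a) \<Rightarrow> ('a \<Rightarrow> ('a \<times> 'a \<Rightarrow>\<^sub>0 'k) set) \<Rightarrow> 'a monoid" where
  "grouplike_group sc \<Delta> = \<lparr>carrier = grouplikes sc \<Delta>, monoid.mult = (*), one = 1\<rparr>"

definition skew_primitives ::
  "('k::field \<Rightarrow> 'a::ring_1 \<Rightarrow> 'a) \<Rightarrow> ('a \<Rightarrow> ('a \<times> 'a \<Rightarrow>\<^sub>0 'k) set) \<Rightarrow> 'a \<Rightarrow> 'a \<Rightarrow> 'a set" where
  "skew_primitives sc \<Delta> t s = {x. \<Delta> x = tensor2 sc [(x, t), (s, x)]}"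

definition partial_action ::
  "('k::field \<Rightarrow> 'a::ring_1 \<Rightarrow> 'a) \<Rightarrow> ('a \<Rightarrow> ('a \<times> 'a \<Rightarrow>\<^sub>0 'k) set) \<Rightarrow> ('a \<Rightarrow> 'k) \<Rightarrow> bool" where
  "partial_action sc \<Delta> lam \<longleftrightarrow>
     Vector_Spaces.linear sc (*) lam \<and> lam 1 = 1 \<and>
     (\<forall>h k. lam h * lam k = (\<Sum>(h\<^sub>1, h\<^sub>2)\<leftarrow>sweedler sc (\<Delta> h). lam h\<^sub>1 * lam (h\<^sub>2 * k)))"


section \<open>Polynomial systems\<close>

text \<open>
  Polynomials over \<open>'k\<close> in unknowns \<open>X\<^sub>b\<close> indexed by \<open>b :: 'a\<close>: finitely supported maps from
  monomials (finitely supported exponent functions) to coefficients. Only the \<open>X\<^sub>b\<close> with \<open>b\<close> in the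
  given basis occur in the image of \<open>Lam\<close> below. An equation is a pair of polynomials.
\<close>

type_synonym ('a, 'k) mpol = "('a \<Rightarrow>\<^sub>0 nat) \<Rightarrow>\<^sub>0 'k"

definition unknown :: "'a \<Rightarrow> ('a, 'k::field) mpol" where
  "unknown b = Poly_Mapping.single (Poly_Mapping.single b 1) 1"

definition const_pol :: "'k::field \<Rightarrow> ('a, 'k) mpol" where
  "const_pol c = Poly_Mapping.single 0 c"

definition eval_pol :: "('a \<Rightarrow> 'k::field) \<Rightarrow> ('a, 'k) mpol \<Rightarrow> 'k" where
  "eval_pol \<alpha> p =
     (\<Sum>m\<in>Poly_Mapping.keys p. Poly_Mapping.lookup p m *
        (\<Prod>b\<in>Poly_Mapping.keys m. \<alpha> b ^ Poly_Mapping.lookup m b))"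

definition is_solution ::
  "('a \<Rightarrow> 'k::field) \<Rightarrow> (('a, 'k) mpol \<times> ('a, 'k) mpol) set \<Rightarrow> bool" where
  "is_solution \<alpha> E \<longleftrightarrow> (\<forall>(p, q)\<in>E. eval_pol \<alpha> p = eval_pol \<alpha> q)"

definition is_basis :: "('k::field \<Rightarrow> 'a::ab_group_add \<Rightarrow> 'a) \<Rightarrow> 'a set \<Rightarrow> bool" where
  "is_basis sc B \<longleftrightarrow> \<not> module.dependent sc B \<and> module.span sc B = UNIV"

text \<open>The linear map with \<open>b \<mapsto> X\<^sub>b\<close> for \<open>b \<in> B\<close>, written out via coordinates in the basis \<open>B\<close>.\<close>

definition Lam ::
  "('k::field \<Rightarrow> 'a::ab_group_add \<Rightarrow> 'a) \<Rightarrow> 'a set \<Rightarrow> 'a \<Rightarrow> ('a, 'k) mpol" where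
  "Lam sc B h =
     (\<Sum>b | module.representation sc B h b \<noteq> 0.
        const_pol (module.representation sc B h b) * unknown b)"


section \<open>Initial conditions and the reduced partial system\<close>

text \<open>Below, \<open>B'\<close> is such that \<open>grouplikes sc \<Delta> \<union> B'\<close> is a basis.\<close>

definition initial_system ::
  "('k::field \<Rightarrow> 'a::ring_1 \<Rightarrow> 'a) \<Rightarrow> ('a \<Rightarrow> ('a \<times> 'a \<Rightarrow>\<^sub>0 'k) set) \<Rightarrow> 'a set \<Rightarrow> 'a set
    \<Rightarrow> (('a, 'k) mpol \<times> ('a, 'k) mpol) set" where
  "initial_system sc \<Delta> B' N =
    (let \<Lambda> = Lam sc (grouplikes sc \<Delta> \<union> B') in
       {(\<Lambda> g, const_pol 1) | g. g \<in> N} \<union>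
       {(\<Lambda> h, const_pol 0) | h. h \<in> grouplikes sc \<Delta> - N} \<union>
       {(\<Lambda> u, \<Lambda> (g * u)) | g u. g \<in> N \<and> u \<in> B'})"

definition initial_condition ::
  "('k::field \<Rightarrow> 'a::ring_1 \<Rightarrow> 'a) \<Rightarrow> ('a \<Rightarrow> ('a \<times> 'a \<Rightarrow>\<^sub>0 'k) set) \<Rightarrow> 'a set \<Rightarrow> 'a set
    \<Rightarrow> ('a \<Rightarrow> 'k) \<Rightarrow> bool" where
  "initial_condition sc \<Delta> B' N \<alpha> \<longleftrightarrow> is_solution \<alpha> (initial_system sc \<Delta> B' N)"

definition sim :: "'a::ring_1 set \<Rightarrow> 'a set \<Rightarrow> ('a \<times> 'a) set" where
  "sim B' N = {(x, y). x \<in> B' \<and> y \<in> B' \<and> (\<exists>g\<in>N. y = g * x)}"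

definition is_transversal :: "'a::ring_1 set \<Rightarrow> 'a set \<Rightarrow> 'a set \<Rightarrow> bool" where
  "is_transversal B' N Nt \<longleftrightarrow> Nt \<subseteq> B' \<and> (\<forall>C \<in> B' // sim B' N. \<exists>!x. x \<in> Nt \<and> x \<in> C)"

definition B_ts ::
  "('k::field \<Rightarrow> 'a::ring_1 \<Rightarrow> 'a) \<Rightarrow> ('a \<Rightarrow> ('a \<times> 'a \<Rightarrow>\<^sub>0 'k) set) \<Rightarrow> 'a set \<Rightarrow> 'a \<Rightarrow> 'a
    \<Rightarrow> 'a set" where
  "B_ts sc \<Delta> N t s = {x \<in> skew_primitives sc \<Delta> t s. t \<in> N \<and> s \<in> grouplikes sc \<Delta> - N}"

definition reduced_basis ::
  "('k::field \<Rightarrow> 'a::ring_1 \<Rightarrow> 'a) \<Rightarrow> ('a \<Rightarrow> ('a \<times> 'a \<Rightarrow>\<^sub>0 'k) set) \<Rightarrow> 'a set \<Rightarrow> 'a set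
    \<Rightarrow> 'a set" where
  "reduced_basis sc \<Delta> N Nt =
     Nt - (\<Union>t\<in>grouplikes sc \<Delta>. \<Union>s\<in>grouplikes sc \<Delta>. B_ts sc \<Delta> N t s)"

definition reduced_system ::
  "('k::field \<Rightarrow> 'a::ring_1 \<Rightarrow> 'a) \<Rightarrow> ('a \<Rightarrow> ('a \<times> 'a \<Rightarrow>\<^sub>0 'k) set) \<Rightarrow> 'a set \<Rightarrow> 'a set \<Rightarrow> 'a set
    \<Rightarrow> (('a, 'k) mpol \<times> ('a, 'k) mpol) set" where
  "reduced_system sc \<Delta> B' N Nt =
    (let B = grouplikes sc \<Delta> \<union> B'; \<Lambda> = Lam sc B in
       {(\<Lambda> u * \<Lambda> v, \<Sum>(u\<^sub>1, u\<^sub>2)\<leftarrow>sweedler sc (\<Delta> u). \<Lambda> u\<^sub>1 * \<Lambda> (u\<^sub>2 * v)) | u v.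
          u \<in> reduced_basis sc \<Delta> N Nt \<and> v \<in> B})"

end

theory Submission
  imports Defs
begin

text \<open>
  Fix a linear map \<open>lam\<close> and say that the law holds at \<open>(h, k)\<close> if
  \<open>lam h * lam k = \<Sum> lam h\<^sub>1 * lam (h\<^sub>2 * k)\<close>. Both sides are linear in \<open>h\<close> and in \<open>k\<close>, so \<open>lam\<close> is
  a partial action as soon as \<open>lam 1 = 1\<close> and the law holds at all pairs of basis vectors. The
  theorem says which of these pairs carry information.

  At a group-like \<open>g\<close> the law reads \<open>lam g * lam k = lam g * lam (g * k)\<close>. With \<open>k = 1\<close> it gives
  \<open>lam g = lam g ^ 2\<close>, so \<open>lam\<close> takes only the values \<open>0\<close> and \<open>1\<close> on group-likes; at the \<open>g\<close> with
  \<open>lam g = 1\<close> it says that \<open>lam\<close> is invariant under left translation by \<open>g\<close>. These elements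
  therefore form a subgroup \<open>N\<close>, and the initial conditions hold. That a partial action solves the
  reduced system is immediate, since the reduced system consists of instances of the law.

  Conversely, the initial conditions and the subgroup property make \<open>lam\<close> invariant under
  translation by \<open>N\<close> on the whole Hopf algebra (\<open>invariant_of_initial_condition\<close>), which settles
  the law at group-likes. As \<open>\<Delta> (g * h)\<close> is \<open>g \<otimes> g\<close> times \<open>\<Delta> h\<close>, invariance shows that for \<open>g \<in> N\<close>
  the law at \<open>g * h\<close> is the law at \<open>h\<close> (\<open>acts_at_translate\<close>); hence one representative of each
  class of \<open>B'\<close> modulo \<open>N\<close> suffices. If such a representative \<open>x\<close> satisfies
  \<open>\<Delta> x = x \<otimes> t + s \<otimes> x\<close> with \<open>t \<in> N\<close> and \<open>s \<notin> N\<close>, then the right-hand side of the law at \<open>x\<close> is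
  \<open>lam x * lam (t * k) + lam s * lam (x * k) = lam x * lam k\<close>, so the law holds
  (\<open>acts_at_skew_primitive\<close>). The remaining representatives are those of the reduced system.

  Two groups of lemmas make these computations available. Tensors are cosets of formal sums, so
  every evaluation of a Sweedler sum rests on the universal property: a bilinear map has the same sum
  over any two expressions of a tensor (\<open>tensor2_bilinear_map\<close>). And evaluation of polynomials at
  \<open>lam\<close> is a ring homomorphism that sends \<open>Lam sc B h\<close> to \<open>lam h\<close> (\<open>eval_pol_Lam\<close>), which turns the
  polynomial systems into statements about \<open>lam\<close>.
\<close>

section \<open>Linear extension from a free vector space\<close>

lemma lookup_map:
  "g 0 = 0 \<Longrightarrow> Poly_Mapping.lookup (Poly_Mapping.map g p) x = g (Poly_Mapping.lookup p x)"
  by transfer (auto simp: when_def)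

interpretation free: vector_space "\<lambda>(c::'k::field). Poly_Mapping.map (\<lambda>d. c * d) :: ('x \<Rightarrow>\<^sub>0 'k) \<Rightarrow> _"
  by unfold_locales
     (auto intro!: poly_mapping_eqI simp: lookup_map lookup_add algebra_simps)

lemma poly_mapping_single_induct [case_names zero single add]:
  assumes "P 0" "\<And>x c. P (Poly_Mapping.single x c)" "\<And>p q. P p \<Longrightarrow> P q \<Longrightarrow> P (p + q)"
  shows "P (p :: 'x \<Rightarrow>\<^sub>0 'k::comm_monoid_add)"
proof (induction p rule: update_induct)
  case const
  show ?case by (fact assms(1))
next
  case (update f a b)
  have "Poly_Mapping.update a b f = Poly_Mapping.single a b + f"
    using update(1)
    by (intro poly_mapping_eqI)
       (auto simp: lookup_add lookup_update lookup_single when_def in_keys_iff)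
  thus ?case using assms update by simp
qed

definition lin_extension ::
  "('k::field \<Rightarrow> 'v::ab_group_add \<Rightarrow> 'v) \<Rightarrow> ('x \<Rightarrow> 'v) \<Rightarrow> ('x \<Rightarrow>\<^sub>0 'k) \<Rightarrow> 'v" where
  "lin_extension sv f p = (\<Sum>x\<in>Poly_Mapping.keys p. sv (Poly_Mapping.lookup p x) (f x))"

context vector_space
begin

lemma lin_extension_superset:
  fixes p :: "'x \<Rightarrow>\<^sub>0 'a"
  assumes "finite A" "Poly_Mapping.keys p \<subseteq> A"
  shows "lin_extension scale f p = (\<Sum>x\<in>A. scale (Poly_Mapping.lookup p x) (f x))"
  unfolding lin_extension_def using assms
  by (intro sum.mono_neutral_left) (auto simp: in_keys_iff)

lemma lin_extension_add: "lin_extension scale f (p + q) = lin_extension scale f p + lin_extension scale f q"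
proof -
  let ?A = "Poly_Mapping.keys p \<union> Poly_Mapping.keys q"
  have "Poly_Mapping.keys (p + q) \<subseteq> ?A" by (rule keys_add)
  thus ?thesis
    by (simp add: lin_extension_superset[of ?A] lookup_add scale_left_distrib sum.distrib)
qed

lemma lin_extension_single [simp]: "lin_extension scale f (Poly_Mapping.single x c) = scale c (f x)"
  by (simp add: lin_extension_def)

lemma lin_extension_scale:
  "lin_extension scale f (Poly_Mapping.map (\<lambda>d. c * d) p) = scale c (lin_extension scale f p)"
proof -
  have "Poly_Mapping.keys (Poly_Mapping.map (\<lambda>d. c * d) p) \<subseteq> Poly_Mapping.keys p"
    by (auto simp: in_keys_iff lookup_map)
  thus ?thesis
    by (simp add: lin_extension_superset[of "Poly_Mapping.keys p"] lookup_map scale_sum_right)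
qed

lemma lin_extension_zero [simp]: "lin_extension scale f 0 = 0"
  by (simp add: lin_extension_def)

lemma lin_extension_diff: "lin_extension scale f (p - q) = lin_extension scale f p - lin_extension scale f q"
  using lin_extension_add[of f "p - q" q] by simp

lemma lin_extension_formal_sum: "lin_extension scale f (formal_sum xs) = (\<Sum>x\<leftarrow>xs. f x)"
  by (induction xs) (simp_all add: formal_sum_def lin_extension_add)

lemma lin_extension_span:
  assumes "subspace W" "\<And>r. r \<in> R \<Longrightarrow> lin_extension scale f r \<in> W" "p \<in> free_span R"
  shows "lin_extension scale f p \<in> W"
  using assms(3) unfolding free_span_def
proof (induction rule: free.span_induct_alt)
  case base
  thus ?case using subspace_0[OF assms(1)] by simp
next
  case (step c x y)
  thus ?case
    using assms(2)[of x] 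
    by (auto simp: lin_extension_add lin_extension_scale intro: subspace_add[OF assms(1)] subspace_scale[OF assms(1)])
qed

end

section \<open>The universal property of the tensor square\<close>

text \<open>
  Bilinearity up to a subspace \<open>W\<close> of the target. With \<open>W = {0}\<close> this is bilinearity; with \<open>W\<close> the
  span of the relators it is bilinearity of a map with values in the tensor square, stated on
  representatives. One universal property then serves scalar-valued, vector-valued and tensor-valued
  Sweedler sums.
\<close>

definition bilinear_mod ::
  "('k::field \<Rightarrow> 'a::ab_group_add \<Rightarrow> 'a) \<Rightarrow> ('k \<Rightarrow> 'v::ab_group_add \<Rightarrow> 'v) \<Rightarrow> 'v set
    \<Rightarrow> ('a \<times> 'a \<Rightarrow> 'v) \<Rightarrow> bool" where
  "bilinear_mod sc sv W f \<longleftrightarrow>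
     (\<forall>x x' y. f (x + x', y) - (f (x, y) + f (x', y)) \<in> W) \<and>
     (\<forall>x y y'. f (x, y + y') - (f (x, y) + f (x, y')) \<in> W) \<and>
     (\<forall>c x y. f (sc c x, y) - sv c (f (x, y)) \<in> W) \<and>
     (\<forall>c x y. f (x, sc c y) - sv c (f (x, y)) \<in> W)"

lemma refl_free_quot: "(p, p) \<in> free_quot R"
  by (simp add: free_quot_def free_span_def free.span_zero)

lemma equiv_free_quot: "equiv UNIV (free_quot R)"
proof (rule equivI)
  show "refl (free_quot R)" by (auto intro!: reflI refl_free_quot)
  show "sym (free_quot R)"
  proof (rule symI)
    fix p q assume "(p, q) \<in> free_quot R"
    thus "(q, p) \<in> free_quot R"
      using free.span_neg[of "p - q" R] by (simp add: free_quot_def free_span_def)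
  qed
  show "trans (free_quot R)"
  proof (rule transI)
    fix p q r assume "(p, q) \<in> free_quot R" "(q, r) \<in> free_quot R"
    thus "(p, r) \<in> free_quot R"
      using free.span_add[of "p - q" R "q - r"] by (simp add: free_quot_def free_span_def)
  qed
qed simp

lemma tensor2_eq_iff:
  "tensor2 sc xs = tensor2 sc ys \<longleftrightarrow> formal_sum xs - formal_sum ys \<in> free_span (relators2 sc)"
  using eq_equiv_class_iff[OF equiv_free_quot, of "formal_sum xs" "formal_sum ys" "relators2 sc"]
  by (simp add: tensor2_def free_quot_def)

text \<open>
  Equal tensors have formal sums that differ by an element of the span of the relators. The linear
  extension of \<open>f\<close> sends each relator into \<open>W\<close>, for this is what bilinearity modulo \<open>W\<close> says, and so
  it sends the whole span into \<open>W\<close>.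
\<close>

lemma (in vector_space) tensor2_respects:
  assumes W: "subspace W" and f: "bilinear_mod sc scale W f"
    and eq: "tensor2 sc xs = tensor2 sc ys"
  shows "(\<Sum>p\<leftarrow>xs. f p) - (\<Sum>p\<leftarrow>ys. f p) \<in> W"
proof -
  have "lin_extension scale f (formal_sum xs - formal_sum ys) \<in> W"
  proof (rule lin_extension_span[OF W])
    show "formal_sum xs - formal_sum ys \<in> free_span (relators2 sc)"
      using eq by (simp add: tensor2_eq_iff)
    fix r assume "r \<in> relators2 sc"
    thus "lin_extension scale f r \<in> W"
      using f unfolding bilinear_mod_def relators2_def
      by (auto simp: lin_extension_add lin_extension_diff)
  qed
  thus ?thesis by (simp add: lin_extension_diff lin_extension_formal_sum)
qed

interpretation field_self: vector_space "(*) :: 'k::field \<Rightarrow> 'k \<Rightarrow> 'k"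
  by unfold_locales (simp_all add: algebra_simps)

definition bilinear_map ::
  "('k::field \<Rightarrow> 'a::ab_group_add \<Rightarrow> 'a) \<Rightarrow> ('k \<Rightarrow> 'v::ab_group_add \<Rightarrow> 'v)
    \<Rightarrow> ('a \<times> 'a \<Rightarrow> 'v) \<Rightarrow> bool" where
  "bilinear_map sc sv f \<longleftrightarrow>
     (\<forall>y. Vector_Spaces.linear sc sv (\<lambda>x. f (x, y))) \<and>
     (\<forall>x. Vector_Spaces.linear sc sv (\<lambda>y. f (x, y)))"

lemma bilinear_mapI:
  assumes "vector_space sc" "vector_space sv"
    and "\<And>x x' y. f (x + x', y) = f (x, y) + f (x', y)"
    and "\<And>x y y'. f (x, y + y') = f (x, y) + f (x, y')"
    and "\<And>c x y. f (sc c x, y) = sv c (f (x, y))"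
    and "\<And>c x y. f (x, sc c y) = sv c (f (x, y))"
  shows "bilinear_map sc sv f"
  using assms by (simp add: bilinear_map_def Vector_Spaces.linear_def module_hom_def
    module_hom_axioms_def module_iff_vector_space)

lemma bilinear_map_add:
  assumes "bilinear_map sc sv f"
  shows "f (x + x', y) = f (x, y) + f (x', y)" "f (x, y + y') = f (x, y) + f (x, y')"
proof -
  have l: "module_hom sc sv (\<lambda>x. f (x, y))" and r: "module_hom sc sv (\<lambda>y. f (x, y))"
    using assms by (auto simp: bilinear_map_def module_hom_iff_linear)
  show "f (x + x', y) = f (x, y) + f (x', y)" by (rule module_hom.add[OF l])
  show "f (x, y + y') = f (x, y) + f (x, y')" by (rule module_hom.add[OF r])
qed

lemma bilinear_map_scale:
  assumes "bilinear_map sc sv f"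
  shows "f (sc c x, y) = sv c (f (x, y))" "f (x, sc c y) = sv c (f (x, y))"
proof -
  have l: "module_hom sc sv (\<lambda>x. f (x, y))" and r: "module_hom sc sv (\<lambda>y. f (x, y))"
    using assms by (auto simp: bilinear_map_def module_hom_iff_linear)
  show "f (sc c x, y) = sv c (f (x, y))" by (rule module_hom.scale[OF l])
  show "f (x, sc c y) = sv c (f (x, y))" by (rule module_hom.scale[OF r])
qed

lemma tensor2_bilinear_map:
  assumes f: "bilinear_map sc sv f" and eq: "tensor2 sc xs = tensor2 sc ys"
  shows "(\<Sum>p\<leftarrow>xs. f p) = (\<Sum>p\<leftarrow>ys. f p)"
proof -
  interpret vector_space sv
    using f by (auto simp: bilinear_map_def Vector_Spaces.linear_def)
  have "bilinear_mod sc sv {0} f"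
    using f by (simp add: bilinear_mod_def bilinear_map_add bilinear_map_scale)
  from tensor2_respects[OF subspace_single_0 this eq] show ?thesis by simp
qed

text \<open>
  Multiplying a variable simple tensor by a fixed expression \<open>\<Sum> a\<^sub>i \<otimes> b\<^sub>i\<close> is a sum of maps
  \<open>x \<otimes> y \<mapsto> x a\<^sub>i \<otimes> y b\<^sub>i\<close>; with the next lemma this makes products of tensors well defined.
\<close>

lemma bilinear_mod_sum_list:
  assumes "vector_space sv" "module.subspace sv W" "\<And>k. k \<in> set ks \<Longrightarrow> bilinear_mod sc sv W (f k)"
  shows "bilinear_mod sc sv W (\<lambda>p. \<Sum>k\<leftarrow>ks. f k p)"
proof -
  interpret vector_space sv by fact
  note W = assms(2)
  show ?thesis using assms(3)
  proof (induction ks)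
    case Nil
    show ?case using subspace_0[OF W] by (simp add: bilinear_mod_def)
  next
    case (Cons k ks)
    have f: "bilinear_mod sc sv W (f k)" and g: "bilinear_mod sc sv W (\<lambda>p. \<Sum>k\<leftarrow>ks. f k p)"
      using Cons by auto
    have add: "a + b - (c + d) \<in> W" if "a - c \<in> W" "b - d \<in> W" for a b c d
      using subspace_add[OF W that] by (simp add: algebra_simps)
    have add': "a + b - ((c + c') + (d + d')) \<in> W"
      if "a - (c + d) \<in> W" "b - (c' + d') \<in> W" for a b c d c' d'
      using add[OF that] by (simp add: algebra_simps)
    show ?case using f g
      by (auto simp: bilinear_mod_def scale_right_distrib intro!: add add')
  qed
qed

lemma bilinear_mod_single:
  fixes F G :: "'a::ab_group_add \<Rightarrow> 'a"
  assumes "Vector_Spaces.linear sc sc F" "Vector_Spaces.linear sc sc G"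
  shows "bilinear_mod sc (\<lambda>c. Poly_Mapping.map (\<lambda>d. c * d)) (free_span (relators2 sc))
     (\<lambda>(x, y). Poly_Mapping.single (F x, G y) (1::'k::field))"
proof -
  interpret F: module_hom sc sc F using assms(1) by (simp add: module_hom_eq_linear)
  interpret G: module_hom sc sc G using assms(2) by (simp add: module_hom_eq_linear)
  have sub: "relators2 sc \<subseteq> free_span (relators2 sc)"
    unfolding free_span_def by (rule free.span_superset)
  have map1: "Poly_Mapping.map (\<lambda>d. c * d) (Poly_Mapping.single z (1::'k)) = Poly_Mapping.single z c"
    for c and z :: "'a \<times> 'a"
    by (rule poly_mapping_eqI) (simp add: lookup_map lookup_single when_def)
  have rel1: "Poly_Mapping.single (x + x', y) 1
       - (Poly_Mapping.single (x, y) 1 + Poly_Mapping.single (x', y) 1) \<in> relators2 sc" for x x' y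
    unfolding relators2_def by (rule UnI1, rule UnI1, rule UnI1, (rule UN_I[OF UNIV_I])+, rule singletonI)
  have rel2: "Poly_Mapping.single (x, y + y') 1
       - (Poly_Mapping.single (x, y) 1 + Poly_Mapping.single (x, y') 1) \<in> relators2 sc" for x y y'
    unfolding relators2_def by (rule UnI1, rule UnI1, rule UnI2, (rule UN_I[OF UNIV_I])+, rule singletonI)
  have rel3: "Poly_Mapping.single (sc c x, y) 1 - Poly_Mapping.single (x, y) c \<in> relators2 sc" for c x y
    unfolding relators2_def by (rule UnI1, rule UnI2, (rule UN_I[OF UNIV_I])+, rule singletonI)
  have rel4: "Poly_Mapping.single (x, sc c y) 1 - Poly_Mapping.single (x, y) c \<in> relators2 sc" for c x y
    unfolding relators2_def by (rule UnI2, (rule UN_I[OF UNIV_I])+, rule singletonI)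
  show ?thesis unfolding bilinear_mod_def
    by (simp add: F.add G.add F.scale G.scale map1
          rel1[THEN subsetD[OF sub]] rel2[THEN subsetD[OF sub]]
          rel3[THEN subsetD[OF sub]] rel4[THEN subsetD[OF sub]])
qed

definition tensor_times :: "('a::ring_1 \<times> 'a) list \<Rightarrow> ('a \<times> 'a) list \<Rightarrow> ('a \<times> 'a) list" where
  "tensor_times hs ks = [(h\<^sub>1 * k\<^sub>1, h\<^sub>2 * k\<^sub>2). (h\<^sub>1, h\<^sub>2) \<leftarrow> hs, (k\<^sub>1, k\<^sub>2) \<leftarrow> ks]"

lemma formal_sum_append [simp]: "formal_sum (xs @ ys) = formal_sum xs + formal_sum ys"
  by (simp add: formal_sum_def)

text \<open>
  Here and in the next lemma, the outer sum runs over the factor that is to vary and its summand is a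
  bilinear function of a pair, so that \<open>tensor2_respects\<close> applies.
\<close>

lemma formal_sum_times_left:
  "formal_sum (tensor_times hs ks) =
     (\<Sum>h\<leftarrow>hs. \<Sum>k\<leftarrow>ks. case h of (h1, h2) \<Rightarrow> Poly_Mapping.single (h1 * fst k, h2 * snd k) 1)"
  by (induction hs)
     (auto simp: tensor_times_def formal_sum_def o_def split_def)

lemma formal_sum_times_right:
  "formal_sum (tensor_times hs ks) =
     (\<Sum>k\<leftarrow>ks. \<Sum>h\<leftarrow>hs. case k of (k1, k2) \<Rightarrow> Poly_Mapping.single (fst h * k1, snd h * k2) 1)"
  unfolding formal_sum_times_left
  by (induction hs) (simp_all add: sum_list_addf split_def)

text \<open>
  Coefficients can be absorbed, since \<open>c \<cdot> (x, y)\<close> and \<open>(c x, y)\<close> differ by a relator; hence every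
  coset contains a formal sum with all coefficients \<open>1\<close>, and \<open>sweedler\<close> picks an actual expression.
\<close>

lemma exists_tensor2:
  assumes "vector_space sc" "T \<in> tensor_square sc"
  shows "\<exists>xs. tensor2 sc xs = T"
proof -
  interpret vector_space sc by fact
  obtain p where T: "T = free_quot (relators2 sc) `` {p}"
    using assms(2) by (auto simp: tensor_square_def quotient_def)
  have "\<exists>xs. formal_sum xs - p \<in> free_span (relators2 sc)"
  proof (induction p rule: poly_mapping_single_induct)
    case zero
    show ?case by (rule exI[of _ "[]"]) (simp add: formal_sum_def free_span_def free.span_zero)
  next
    case (single z c)
    obtain x y where z: "z = (x, y)" by fastforce
    have "formal_sum [(sc c x, y)] - Poly_Mapping.single z c \<in> relators2 sc"
      by (auto simp: formal_sum_def relators2_def z)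
    thus ?case unfolding free_span_def by (blast intro: free.span_base)
  next
    case (add p q)
    then obtain xs ys where "formal_sum xs - p \<in> free_span (relators2 sc)"
      "formal_sum ys - q \<in> free_span (relators2 sc)" by blast
    hence "(formal_sum xs - p) + (formal_sum ys - q) \<in> free_span (relators2 sc)"
      unfolding free_span_def by (rule free.span_add)
    hence "formal_sum (xs @ ys) - (p + q) \<in> free_span (relators2 sc)"
      by (simp add: algebra_simps)
    thus ?case by blast
  qed
  then obtain xs where "formal_sum xs - p \<in> free_span (relators2 sc)" by blast
  hence "tensor2 sc xs = T"
    unfolding tensor2_def T by (intro equiv_class_eq[OF equiv_free_quot]) (simp add: free_quot_def)
  thus ?thesis by blast
qed

section \<open>Evaluating polynomials\<close>

definition monomial_value :: "('a \<Rightarrow> 'k::field) \<Rightarrow> ('a \<Rightarrow>\<^sub>0 nat) \<Rightarrow> 'k" where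
  "monomial_value \<alpha> m = (\<Prod>b\<in>Poly_Mapping.keys m. \<alpha> b ^ Poly_Mapping.lookup m b)"

lemma monomial_value_superset:
  assumes "finite A" "Poly_Mapping.keys m \<subseteq> A"
  shows "monomial_value \<alpha> m = (\<Prod>b\<in>A. \<alpha> b ^ Poly_Mapping.lookup m b)"
  unfolding monomial_value_def using assms
  by (intro prod.mono_neutral_left) (auto simp: in_keys_iff)

lemma monomial_value_add: "monomial_value \<alpha> (m + n) = monomial_value \<alpha> m * monomial_value \<alpha> n"
proof -
  let ?A = "Poly_Mapping.keys m \<union> Poly_Mapping.keys n"
  have "Poly_Mapping.keys (m + n) \<subseteq> ?A" by (rule keys_add)
  thus ?thesis
    by (simp add: monomial_value_superset[of ?A] lookup_add power_add prod.distrib)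
qed

lemma eval_pol_lin_extension: "eval_pol \<alpha> = lin_extension (*) (monomial_value \<alpha>)"
  by (auto simp: eval_pol_def lin_extension_def monomial_value_def)

lemma eval_pol_add: "eval_pol \<alpha> (p + q) = eval_pol \<alpha> p + eval_pol \<alpha> q"
  by (simp add: eval_pol_lin_extension field_self.lin_extension_add)

lemma eval_pol_single: "eval_pol \<alpha> (Poly_Mapping.single m c) = c * monomial_value \<alpha> m"
  by (simp add: eval_pol_lin_extension)

lemma eval_pol_zero: "eval_pol \<alpha> 0 = 0"
  by (simp add: eval_pol_lin_extension)

lemma eval_pol_mult: "eval_pol \<alpha> (p * q) = eval_pol \<alpha> p * eval_pol \<alpha> q"
proof (induction p rule: poly_mapping_single_induct)
  case zero
  show ?case by (simp only: mult_zero_left eval_pol_zero)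
next
  case (single m c)
  show ?case
  proof (induction q rule: poly_mapping_single_induct)
    case zero
    show ?case by (simp only: mult_zero_right eval_pol_zero)
  next
    case (single n d)
    show ?case
      by (simp only: mult_single eval_pol_single monomial_value_add mult_ac)
  next
    case (add p q)
    thus ?case by (simp only: distrib_left eval_pol_add)
  qed
next
  case (add p p')
  thus ?case by (simp only: distrib_right eval_pol_add)
qed

lemma eval_pol_const [simp]: "eval_pol \<alpha> (const_pol c) = c"
  by (simp add: const_pol_def eval_pol_single monomial_value_def)

lemma eval_pol_unknown [simp]: "eval_pol \<alpha> (unknown b) = \<alpha> b"
  by (simp add: unknown_def eval_pol_single monomial_value_def)

lemma eval_pol_sum: "eval_pol \<alpha> (\<Sum>i\<in>I. p i) = (\<Sum>i\<in>I. eval_pol \<alpha> (p i))"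
  by (induction I rule: infinite_finite_induct) (simp_all add: eval_pol_zero eval_pol_add)

lemma eval_pol_sum_list: "eval_pol \<alpha> (\<Sum>x\<leftarrow>xs. p x) = (\<Sum>x\<leftarrow>xs. eval_pol \<alpha> (p x))"
  by (induction xs) (simp_all add: eval_pol_zero eval_pol_add)

text \<open>
  \<open>Lam sc B h\<close> is \<open>\<Sum> c\<^sub>b X\<^sub>b\<close> for the coordinates \<open>c\<^sub>b\<close> of \<open>h\<close>. A solution \<open>X\<^sub>b = lam b\<close> of a system
  therefore amounts to the same equations with \<open>lam\<close> in place of the formal map.
\<close>

lemma eval_pol_Lam:
  assumes lam: "Vector_Spaces.linear sc (*) lam" and B: "is_basis sc B"
  shows "eval_pol lam (Lam sc B h) = lam h"
proof -
  interpret lam: Vector_Spaces.linear sc "(*)" lam by fact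
  let ?r = "module.representation sc B h"
  have "lam h = lam (\<Sum>b | ?r b \<noteq> 0. sc (?r b) b)"
    using B by (subst lam.vs1.sum_nonzero_representation_eq) (auto simp: is_basis_def)
  also have "\<dots> = eval_pol lam (Lam sc B h)"
    by (simp add: Lam_def eval_pol_sum eval_pol_mult lam.sum lam.scale)
  finally show ?thesis ..
qed

section \<open>Sweedler sums and group-like elements\<close>

context hopf_algebra
begin

lemma linear_mult_left: "Vector_Spaces.linear sc sc (\<lambda>x. a * x)"
  by unfold_locales (simp_all add: distrib_left sc_mult_right)

lemma linear_mult_right: "Vector_Spaces.linear sc sc (\<lambda>x. x * a)"
  by unfold_locales (simp_all add: distrib_right sc_mult_left)

lemma tensor2_times_left_cong:
  assumes "tensor2 sc hs = tensor2 sc hs'"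
  shows "tensor2 sc (tensor_times hs ks) = tensor2 sc (tensor_times hs' ks)"
proof -
  let ?f = "\<lambda>q. \<lambda>(x, y). Poly_Mapping.single (x * fst q, y * snd q) 1"
  have W: "free.subspace (free_span (relators2 sc))"
    unfolding free_span_def by (rule free.subspace_span)
  have "bilinear_mod sc (\<lambda>c. Poly_Mapping.map (\<lambda>d. c * d)) (free_span (relators2 sc))
          (\<lambda>p. \<Sum>q\<leftarrow>ks. ?f q p)"
    by (rule bilinear_mod_sum_list[OF free.vector_space_axioms W])
       (rule bilinear_mod_single[OF linear_mult_right linear_mult_right])
  from free.tensor2_respects[OF W this assms] show ?thesis
    by (simp add: tensor2_eq_iff formal_sum_times_left)
qed

lemma tensor2_times_right_cong:
  assumes "tensor2 sc ks = tensor2 sc ks'"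
  shows "tensor2 sc (tensor_times hs ks) = tensor2 sc (tensor_times hs ks')"
proof -
  let ?f = "\<lambda>q. \<lambda>(x, y). Poly_Mapping.single (fst q * x, snd q * y) 1"
  have W: "free.subspace (free_span (relators2 sc))"
    unfolding free_span_def by (rule free.subspace_span)
  have "bilinear_mod sc (\<lambda>c. Poly_Mapping.map (\<lambda>d. c * d)) (free_span (relators2 sc))
          (\<lambda>p. \<Sum>q\<leftarrow>hs. ?f q p)"
    by (rule bilinear_mod_sum_list[OF free.vector_space_axioms W])
       (rule bilinear_mod_single[OF linear_mult_left linear_mult_left])
  from free.tensor2_respects[OF W this assms] show ?thesis
    by (simp add: tensor2_eq_iff formal_sum_times_right)
qed

lemma tensor2_sweedler: "tensor2 sc (sweedler sc (\<Delta> h)) = \<Delta> h"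
  unfolding sweedler_def
  by (rule someI_ex[OF exists_tensor2[OF vector_space_axioms comult_tensor]])

text \<open>
  Multiplicativity of the comultiplication for arbitrary expressions of \<open>\<Delta> h\<close> and \<open>\<Delta> k\<close> instead of
  the ones chosen by \<open>sweedler\<close>.
\<close>

lemma comult_times:
  assumes "\<Delta> h = tensor2 sc hs" "\<Delta> k = tensor2 sc ks"
  shows "\<Delta> (h * k) = tensor2 sc (tensor_times hs ks)"
proof -
  have "\<Delta> (h * k) = tensor2 sc (tensor_times (sweedler sc (\<Delta> h)) (sweedler sc (\<Delta> k)))"
    unfolding tensor_times_def by (rule comult_mult)
  also have "\<dots> = tensor2 sc (tensor_times hs (sweedler sc (\<Delta> k)))"
    by (intro tensor2_times_left_cong) (simp add: tensor2_sweedler assms(1)[symmetric])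
  also have "\<dots> = tensor2 sc (tensor_times hs ks)"
    by (intro tensor2_times_right_cong) (simp add: tensor2_sweedler assms(2)[symmetric])
  finally show ?thesis .
qed

lemma sweedler_sum:
  assumes "bilinear_map sc sv f" "\<Delta> h = tensor2 sc hs"
  shows "(\<Sum>p\<leftarrow>sweedler sc (\<Delta> h). f p) = (\<Sum>p\<leftarrow>hs. f p)"
  by (rule tensor2_bilinear_map[OF assms(1)]) (simp add: tensor2_sweedler assms(2)[symmetric])

lemma linear_sweedler_sum:
  assumes f: "bilinear_map sc (*) f"
  shows "Vector_Spaces.linear sc (*) (\<lambda>h. \<Sum>p\<leftarrow>sweedler sc (\<Delta> h). f p)"
proof
  fix h k c
  show "(\<Sum>p\<leftarrow>sweedler sc (\<Delta> (h + k)). f p) =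
        (\<Sum>p\<leftarrow>sweedler sc (\<Delta> h). f p) + (\<Sum>p\<leftarrow>sweedler sc (\<Delta> k). f p)"
    by (simp add: sweedler_sum[OF f comult_add])
  show "(\<Sum>p\<leftarrow>sweedler sc (\<Delta> (sc c h)). f p) = c * (\<Sum>p\<leftarrow>sweedler sc (\<Delta> h). f p)"
    by (simp add: sweedler_sum[OF f comult_sc] o_def split_def bilinear_map_scale[OF f]
          sum_list_const_mult)
qed

lemma bilinear_map_scale_linear:
  assumes "Vector_Spaces.linear sc (*) \<phi>"
  shows "bilinear_map sc sc (\<lambda>(x, y). sc (\<phi> x) y)"
proof -
  interpret \<phi>: module_hom sc "(*)" \<phi> using assms by (simp add: module_hom_iff_linear)
  show ?thesis
    by (rule bilinear_mapI[OF vector_space_axioms vector_space_axioms])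
       (simp_all add: \<phi>.add \<phi>.scale scale_left_distrib scale_right_distrib mult.commute)
qed

lemma bilinear_map_times_linear:
  assumes "Vector_Spaces.linear sc sc F" "Vector_Spaces.linear sc sc G"
  shows "bilinear_map sc sc (\<lambda>(x, y). F x * G y)"
proof -
  interpret F: module_hom sc sc F using assms(1) by (simp add: module_hom_iff_linear)
  interpret G: module_hom sc sc G using assms(2) by (simp add: module_hom_iff_linear)
  show ?thesis
    by (rule bilinear_mapI[OF vector_space_axioms vector_space_axioms])
       (simp_all add: F.add F.scale G.add G.scale sc_mult_left sc_mult_right distrib_left distrib_right)
qed

lemma bilinear_map_partial_action:
  assumes "Vector_Spaces.linear sc (*) lam"
  shows "bilinear_map sc (*) (\<lambda>(x, y). lam x * lam (y * k))"
proof -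
  interpret lam: module_hom sc "(*)" lam using assms by (simp add: module_hom_iff_linear)
  show ?thesis
    by (rule bilinear_mapI[OF vector_space_axioms field_self.vector_space_axioms])
       (simp_all add: lam.add lam.scale sc_mult_left distrib_left distrib_right mult.left_commute)
qed

lemma grouplike_nonzero: "g \<in> grouplikes sc \<Delta> \<Longrightarrow> g \<noteq> 0"
  and grouplike_comult: "g \<in> grouplikes sc \<Delta> \<Longrightarrow> \<Delta> g = tensor2 sc [(g, g)]"
  by (simp_all add: grouplikes_def)

lemma counit_grouplike:
  assumes "g \<in> grouplikes sc \<Delta>"
  shows "\<epsilon> g = 1"
proof -
  have "sc (\<epsilon> g) g = sc 1 g"
    using counit_left[of g]
    by (simp add: sweedler_sum[OF bilinear_map_scale_linear[OF counit_linear] grouplike_comult[OF assms]])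
  thus ?thesis using grouplike_nonzero[OF assms] by (simp only: scale_cancel_right) simp
qed

lemma antipode_grouplike:
  assumes "g \<in> grouplikes sc \<Delta>"
  shows "S g * g = 1" "g * S g = 1"
proof -
  have "bilinear_map sc sc (\<lambda>(x, y). S x * y)" "bilinear_map sc sc (\<lambda>(x, y). x * S y)"
    using bilinear_map_times_linear[OF antipode_linear linear_ident]
      bilinear_map_times_linear[OF linear_ident antipode_linear] by simp_all
  thus "S g * g = 1" "g * S g = 1"
    using antipode_left[of g] antipode_right[of g]
    by (simp_all add: sweedler_sum[OF _ grouplike_comult[OF assms]] counit_grouplike[OF assms])
qed

lemma one_grouplike: "1 \<in> grouplikes sc \<Delta>"
  by (simp add: grouplikes_def comult_one)

lemma mult_grouplike:
  assumes g: "g \<in> grouplikes sc \<Delta>" and h: "h \<in> grouplikes sc \<Delta>"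
  shows "g * h \<in> grouplikes sc \<Delta>"
proof -
  \<comment> \<open>a Hopf algebra may have zero divisors; the counit, being multiplicative, separates \<open>g * h\<close> from \<open>0\<close>\<close>
  have "\<epsilon> (g * h) \<noteq> \<epsilon> 0"
    using counit_linear by (simp add: counit_mult counit_grouplike g h module_hom.zero
                                  flip: module_hom_iff_linear)
  hence "g * h \<noteq> 0" by metis
  thus ?thesis
    using comult_times[OF grouplike_comult[OF g] grouplike_comult[OF h]]
    by (simp add: grouplikes_def tensor_times_def)
qed

text \<open>
  As \<open>S g\<close> is inverse to \<open>g\<close>, the element \<open>\<Delta> (S g)\<close> is a left inverse of \<open>\<Delta> g = g \<otimes> g\<close> in the algebra
  \<open>H \<otimes> H\<close>, and multiplying \<open>\<Delta> (S g) (g \<otimes> g) = 1 \<otimes> 1\<close> on the right by \<open>S g \<otimes> S g\<close> leaves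
  \<open>\<Delta> (S g) = S g \<otimes> S g\<close>.
\<close>

lemma antipode_mem_grouplikes:
  assumes g: "g \<in> grouplikes sc \<Delta>"
  shows "S g \<in> grouplikes sc \<Delta>"
proof -
  let ?hs = "sweedler sc (\<Delta> (S g))"
  have cancel: "tensor_times (tensor_times hs [(g, g)]) [(S g, S g)] = hs" for hs
    by (induction hs) (auto simp: tensor_times_def mult.assoc antipode_grouplike g)
  have "tensor2 sc (tensor_times ?hs [(g, g)]) = \<Delta> (S g * g)"
    by (rule comult_times[symmetric]) (simp_all add: tensor2_sweedler grouplike_comult g)
  also have "\<dots> = tensor2 sc [(1, 1)]" by (simp add: antipode_grouplike g comult_one)
  finally have "tensor2 sc (tensor_times (tensor_times ?hs [(g, g)]) [(S g, S g)])
      = tensor2 sc (tensor_times [(1, 1)] [(S g, S g)])"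
    by (rule tensor2_times_left_cong)
  hence "\<Delta> (S g) = tensor2 sc [(S g, S g)]"
    unfolding cancel tensor2_sweedler by (simp add: tensor_times_def)
  moreover have "S g \<noteq> 0" using antipode_grouplike[OF g] by auto
  ultimately show ?thesis by (simp add: grouplikes_def)
qed

lemma group_grouplikes: "group (grouplike_group sc \<Delta>)"
proof (rule groupI)
  fix g assume "g \<in> carrier (grouplike_group sc \<Delta>)"
  thus "\<exists>h\<in>carrier (grouplike_group sc \<Delta>). h \<otimes>\<^bsub>grouplike_group sc \<Delta>\<^esub> g = \<one>\<^bsub>grouplike_group sc \<Delta>\<^esub>"
    by (auto simp: grouplike_group_def antipode_grouplike intro!: bexI[of _ "S g"] antipode_mem_grouplikes)
qed (auto simp: grouplike_group_def mult_grouplike one_grouplike mult.assoc)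

lemma inv_grouplike:
  "g \<in> grouplikes sc \<Delta> \<Longrightarrow> inv\<^bsub>grouplike_group sc \<Delta>\<^esub> g = S g"
  by (rule group.inv_equality[OF group_grouplikes])
     (simp_all add: grouplike_group_def antipode_grouplike antipode_mem_grouplikes)

end

section \<open>The law of a partial action at a pair of vectors\<close>

definition acts_at ::
  "('k::field \<Rightarrow> 'a::ring_1 \<Rightarrow> 'a) \<Rightarrow> ('a \<Rightarrow> ('a \<times> 'a \<Rightarrow>\<^sub>0 'k) set) \<Rightarrow> ('a \<Rightarrow> 'k)
    \<Rightarrow> 'a \<Rightarrow> 'a \<Rightarrow> bool" where
  "acts_at sc \<Delta> lam h k \<longleftrightarrow>
     lam h * lam k = (\<Sum>(h\<^sub>1, h\<^sub>2)\<leftarrow>sweedler sc (\<Delta> h). lam h\<^sub>1 * lam (h\<^sub>2 * k))"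

lemma linear_eq_on_basis:
  assumes "Vector_Spaces.linear sc (*) F" "Vector_Spaces.linear sc (*) G"
    and "is_basis sc B" "\<And>b. b \<in> B \<Longrightarrow> F b = G b"
  shows "F h = G h"
proof -
  interpret vector_space_pair sc "(*)"
    using assms(1) by (simp add: vector_space_pair_def Vector_Spaces.linear_def)
  show ?thesis
    by (rule linear_eq_on[OF assms(1,2), of _ B]) (use assms(3,4) in \<open>auto simp: is_basis_def\<close>)
qed

context hopf_algebra
begin

lemma linear_const_mult:
  assumes "Vector_Spaces.linear sc (*) F"
  shows "Vector_Spaces.linear sc (*) (\<lambda>x. c * F x)"
proof -
  interpret F: module_hom sc "(*)" F using assms by (simp add: module_hom_iff_linear)
  show ?thesis by unfold_locales (simp_all add: F.add F.scale distrib_left mult.left_commute)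
qed

lemma linear_sum_list:
  assumes "\<And>x. Vector_Spaces.linear sc (*) (F x)"
  shows "Vector_Spaces.linear sc (*) (\<lambda>k. \<Sum>x\<leftarrow>xs. F x k)"
proof (induction xs)
  case Nil
  show ?case by unfold_locales simp_all
next
  case (Cons x xs)
  interpret F: module_hom sc "(*)" "F x" using assms by (simp add: module_hom_iff_linear)
  interpret G: module_hom sc "(*)" "\<lambda>k. \<Sum>x\<leftarrow>xs. F x k"
    using Cons by (simp add: module_hom_iff_linear)
  show ?case by unfold_locales (simp_all add: F.add F.scale G.add G.scale distrib_left)
qed

context
  fixes lam :: "'a \<Rightarrow> 'k"
  assumes lam_linear: "Vector_Spaces.linear sc (*) lam"
begin

interpretation lam: Vector_Spaces.linear sc "(*)" lam by (fact lam_linear)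

lemma acts_at_iff:
  assumes "\<Delta> h = tensor2 sc hs"
  shows "acts_at sc \<Delta> lam h k \<longleftrightarrow> lam h * lam k = (\<Sum>(h\<^sub>1, h\<^sub>2)\<leftarrow>hs. lam h\<^sub>1 * lam (h\<^sub>2 * k))"
  by (simp add: acts_at_def sweedler_sum[OF bilinear_map_partial_action[OF lam_linear] assms])

lemma acts_at_grouplike:
  "g \<in> grouplikes sc \<Delta> \<Longrightarrow> acts_at sc \<Delta> lam g k \<longleftrightarrow> lam g * lam k = lam g * lam (g * k)"
  by (simp add: acts_at_iff[OF grouplike_comult])

lemma linear_lam_times: "Vector_Spaces.linear sc (*) (\<lambda>x. lam (a * x))"
  by unfold_locales (simp_all add: distrib_left sc_mult_right lam.add lam.scale)

lemma acts_at_right_from_basis: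
  assumes B: "is_basis sc B" and "\<And>v. v \<in> B \<Longrightarrow> acts_at sc \<Delta> lam h v"
  shows "acts_at sc \<Delta> lam h k"
proof -
  have "Vector_Spaces.linear sc (*)
          (\<lambda>k. \<Sum>p\<leftarrow>sweedler sc (\<Delta> h). lam (fst p) * lam (snd p * k))"
    by (intro linear_sum_list linear_const_mult linear_lam_times)
  from linear_eq_on_basis[OF linear_const_mult[OF lam_linear] this B]
  show ?thesis using assms(2) unfolding acts_at_def split_def by blast
qed

lemma acts_at_left_from_basis:
  assumes B: "is_basis sc B" and "\<And>u. u \<in> B \<Longrightarrow> acts_at sc \<Delta> lam u k"
  shows "acts_at sc \<Delta> lam h k"
proof -
  have "Vector_Spaces.linear sc (*) (\<lambda>h. lam h * lam k)"
    using linear_const_mult[OF lam_linear, of "lam k"] by (simp add: mult.commute)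
  from linear_eq_on_basis[OF this linear_sweedler_sum[OF bilinear_map_partial_action[OF lam_linear]] B]
    assms(2)
  show ?thesis unfolding acts_at_def by blast
qed

lemma initial_condition_iff:
  assumes "is_basis sc (grouplikes sc \<Delta> \<union> B')"
  shows "initial_condition sc \<Delta> B' N lam \<longleftrightarrow>
     (\<forall>g\<in>N. lam g = 1) \<and> (\<forall>h\<in>grouplikes sc \<Delta> - N. lam h = 0) \<and>
     (\<forall>g\<in>N. \<forall>u\<in>B'. lam u = lam (g * u))"
proof -
  have union: "is_solution lam (X \<union> Y) \<longleftrightarrow> is_solution lam X \<and> is_solution lam Y" for X Y
    by (auto simp: is_solution_def)
  have one: "is_solution lam {(p x, q x) | x. x \<in> A} \<longleftrightarrow> (\<forall>x\<in>A. eval_pol lam (p x) = eval_pol lam (q x))"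
    for p q :: "'a \<Rightarrow> _" and A
    by (auto simp: is_solution_def)
  have two: "is_solution lam {(p g u, q g u) | g u. g \<in> A \<and> u \<in> C} \<longleftrightarrow>
      (\<forall>g\<in>A. \<forall>u\<in>C. eval_pol lam (p g u) = eval_pol lam (q g u))"
    for p q :: "'a \<Rightarrow> 'a \<Rightarrow> _" and A C
    unfolding is_solution_def by blast
  show ?thesis
    unfolding initial_condition_def initial_system_def Let_def union one two
    by (simp only: eval_pol_Lam[OF lam_linear assms] eval_pol_const conj_assoc)
qed

lemma reduced_solution_iff:
  assumes "is_basis sc (grouplikes sc \<Delta> \<union> B')"
  shows "is_solution lam (reduced_system sc \<Delta> B' N Nt) \<longleftrightarrow>
     (\<forall>u\<in>reduced_basis sc \<Delta> N Nt. \<forall>v\<in>grouplikes sc \<Delta> \<union> B'. acts_at sc \<Delta> lam u v)"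
proof -
  let ?L = "Lam sc (grouplikes sc \<Delta> \<union> B')"
  note eval = eval_pol_Lam[OF lam_linear assms]
  have "eval_pol lam (?L u * ?L v) =
          eval_pol lam (\<Sum>(u\<^sub>1, u\<^sub>2)\<leftarrow>sweedler sc (\<Delta> u). ?L u\<^sub>1 * ?L (u\<^sub>2 * v)) \<longleftrightarrow>
        acts_at sc \<Delta> lam u v" for u v
    by (simp add: eval_pol_mult eval_pol_sum_list eval split_def acts_at_def)
  thus ?thesis
    unfolding is_solution_def reduced_system_def Let_def by blast
qed

lemma partial_action_iff_acts_at:
  "partial_action sc \<Delta> lam \<longleftrightarrow> lam 1 = 1 \<and> (\<forall>h k. acts_at sc \<Delta> lam h k)"
  using lam_linear by (simp add: partial_action_def acts_at_def)

text \<open>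
  In the two terms \<open>lam x * lam (t * k)\<close> and \<open>lam s * lam (x * k)\<close> of the right-hand side, the factor
  \<open>t\<close> is absorbed and the second term vanishes. This is why such \<open>x\<close> impose no condition.
\<close>

lemma acts_at_skew_primitive:
  assumes "x \<in> skew_primitives sc \<Delta> t s" "lam (t * k) = lam k" "lam s = 0"
  shows "acts_at sc \<Delta> lam x k"
proof -
  have "\<Delta> x = tensor2 sc [(x, t), (s, x)]" using assms(1) by (simp add: skew_primitives_def)
  thus ?thesis using assms by (simp add: acts_at_iff)
qed

text \<open>
  The terms of \<open>\<Delta> (g * h)\<close> are \<open>g * h\<^sub>1\<close> and \<open>g * h\<^sub>2\<close>, so invariance removes \<open>g\<close> from
  both sides of the law. This reduces \<open>B'\<close> to a transversal.
\<close>

lemma acts_at_translate: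
  assumes g: "g \<in> grouplikes sc \<Delta>" and inv: "\<And>x. lam (g * x) = lam x"
  shows "acts_at sc \<Delta> lam (g * h) k \<longleftrightarrow> acts_at sc \<Delta> lam h k"
proof -
  have "\<Delta> (g * h) = tensor2 sc (tensor_times [(g, g)] (sweedler sc (\<Delta> h)))"
    by (rule comult_times) (simp_all add: grouplike_comult g tensor2_sweedler)
  from acts_at_iff[OF this] show ?thesis
    by (simp add: acts_at_def tensor_times_def split_def o_def inv mult.assoc)
qed

section \<open>Partial actions and the reduced system\<close>

lemma partial_action_imp_subgroup:
  assumes "partial_action sc \<Delta> lam" and N: "N = {g \<in> grouplikes sc \<Delta>. lam g = 1}"
  shows "subgroup N (grouplike_group sc \<Delta>)"
proof -
  have one: "lam 1 = 1" and act: "acts_at sc \<Delta> lam h k" for h k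
    using assms(1) by (auto simp: partial_action_iff_acts_at)
  have inv: "lam (g * k) = lam k" if "g \<in> N" for g k
    using that act[of g k] by (simp add: N acts_at_grouplike)
  show ?thesis
  proof
    show "N \<subseteq> carrier (grouplike_group sc \<Delta>)" by (auto simp: N grouplike_group_def)
    show "\<one>\<^bsub>grouplike_group sc \<Delta>\<^esub> \<in> N" by (simp add: N grouplike_group_def one_grouplike one)
    fix g assume g: "g \<in> N"
    hence G: "g \<in> grouplikes sc \<Delta>" by (simp add: N)
    show "inv\<^bsub>grouplike_group sc \<Delta>\<^esub> g \<in> N"
      using inv[OF g, of "S g"] G
      by (simp add: inv_grouplike antipode_grouplike antipode_mem_grouplikes one N)
    fix h assume h: "h \<in> N"
    show "g \<otimes>\<^bsub>grouplike_group sc \<Delta>\<^esub> h \<in> N"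
      using inv[OF g, of h] G h by (simp add: grouplike_group_def N mult_grouplike)
  qed
qed

lemma partial_action_imp_initial_condition:
  assumes "partial_action sc \<Delta> lam" and N: "N = {g \<in> grouplikes sc \<Delta>. lam g = 1}"
    and B: "is_basis sc (grouplikes sc \<Delta> \<union> B')"
  shows "initial_condition sc \<Delta> B' N lam"
proof -
  have one: "lam 1 = 1" and act: "acts_at sc \<Delta> lam h k" for h k
    using assms(1) by (auto simp: partial_action_iff_acts_at)
  \<comment> \<open>the law at \<open>(h, 1)\<close> makes \<open>lam h\<close> idempotent, and \<open>h \<notin> N\<close> excludes the value \<open>1\<close>\<close>
  have "lam h = 0" if "h \<in> grouplikes sc \<Delta> - N" for h
    using that act[of h 1] by (simp add: N acts_at_grouplike one)
  moreover have "lam g = 1" if "g \<in> N" for g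
    using that by (simp add: N)
  moreover have "lam u = lam (g * u)" if "g \<in> N" for g u
    using that act[of g u] by (simp add: N acts_at_grouplike)
  ultimately show ?thesis
    unfolding initial_condition_iff[OF B] by blast
qed

text \<open>
  The initial conditions give invariance on \<open>B'\<close>. On group-likes, \<open>lam\<close> is the indicator function of
  \<open>N\<close>, which is invariant because left translation by an element of a subgroup preserves both the
  subgroup and its complement. A linear map is determined on the basis.
\<close>

lemma invariant_of_initial_condition:
  assumes sub: "subgroup N (grouplike_group sc \<Delta>)"
    and ic: "initial_condition sc \<Delta> B' N lam"
    and B: "is_basis sc (grouplikes sc \<Delta> \<union> B')"
    and g: "g \<in> N"
  shows "lam (g * x) = lam x"
proof (rule linear_eq_on_basis[OF linear_lam_times lam_linear B])
  note ic = ic[unfolded initial_condition_iff[OF B]]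
  have G: "g \<in> grouplikes sc \<Delta>"
    using subgroup.subset[OF sub] g by (auto simp: grouplike_group_def)
  fix b assume "b \<in> grouplikes sc \<Delta> \<union> B'"
  then consider "b \<in> B'" | "b \<in> N" | "b \<in> grouplikes sc \<Delta> - N" by blast
  thus "lam (g * b) = lam b"
  proof cases
    case 1
    thus ?thesis using ic g by simp
  next
    case 2
    hence "g * b \<in> N" using subgroup.m_closed[OF sub g] by (simp add: grouplike_group_def)
    thus ?thesis using ic 2 by simp
  next
    case 3
    have "g * b \<notin> N"
    proof
      assume "g * b \<in> N"
      moreover have "S g \<in> N"
        using subgroup.m_inv_closed[OF sub g] by (simp add: inv_grouplike[OF G])
      ultimately have "S g * (g * b) \<in> N"
        using subgroup.m_closed[OF sub] by (simp add: grouplike_group_def)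
      thus False using 3 antipode_grouplike(1)[OF G] by (simp flip: mult.assoc)
    qed
    moreover have "g * b \<in> grouplikes sc \<Delta>" using mult_grouplike[OF G] 3 by simp
    ultimately show ?thesis using ic 3 by simp
  qed
qed

text \<open>
  The class of \<open>b\<close> consists of the translates of \<open>b\<close> that lie in \<open>B'\<close>, so its representative is one.
\<close>

lemma transversal_translate:
  assumes "is_transversal B' N Nt" "b \<in> B'"
  obtains g where "g \<in> N" "g * b \<in> Nt"
proof -
  have "sim B' N `` {b} \<in> B' // sim B' N" using assms(2) by (rule quotientI)
  then obtain u where "u \<in> Nt" "u \<in> sim B' N `` {b}"
    using assms(1) unfolding is_transversal_def by blast
  thus thesis using that by (auto simp: sim_def)
qed

lemma partial_action_of_reduced_system:
  assumes sub: "subgroup N (grouplike_group sc \<Delta>)"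
    and ic: "initial_condition sc \<Delta> B' N lam"
    and red: "is_solution lam (reduced_system sc \<Delta> B' N Nt)"
    and B: "is_basis sc (grouplikes sc \<Delta> \<union> B')"
    and Nt: "is_transversal B' N Nt"
  shows "partial_action sc \<Delta> lam"
proof -
  note inv = invariant_of_initial_condition[OF sub ic B]
  have zero: "lam h = 0" if "h \<in> grouplikes sc \<Delta> - N" for h
    using ic that unfolding initial_condition_iff[OF B] by blast
  have one_on: "lam g = 1" if "g \<in> N" for g
    using ic that unfolding initial_condition_iff[OF B] by blast
  note red = red[unfolded reduced_solution_iff[OF B]]
  have N: "N \<subseteq> grouplikes sc \<Delta>" and one: "1 \<in> N"
    using subgroup.subset[OF sub] subgroup.one_closed[OF sub] by (auto simp: grouplike_group_def)
  have rep: "acts_at sc \<Delta> lam u k" if u: "u \<in> Nt" for u k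
  proof (cases "u \<in> reduced_basis sc \<Delta> N Nt")
    case True
    show ?thesis by (rule acts_at_right_from_basis[OF B]) (use red True in blast)
  next
    case False
    then obtain t s where "u \<in> skew_primitives sc \<Delta> t s" "t \<in> N" "s \<in> grouplikes sc \<Delta> - N"
      using u by (auto simp: reduced_basis_def B_ts_def)
    thus ?thesis by (intro acts_at_skew_primitive[of u t s] inv zero)
  qed
  have "acts_at sc \<Delta> lam b k" if "b \<in> grouplikes sc \<Delta> \<union> B'" for b k
  proof -
    consider "b \<in> B'" | "b \<in> N" | "b \<in> grouplikes sc \<Delta> - N" using \<open>b \<in> _\<close> by blast
    thus ?thesis
    proof cases
      case 1
      then obtain g where g: "g \<in> N" "g * b \<in> Nt" by (rule transversal_translate[OF Nt])
      have "g \<in> grouplikes sc \<Delta>" using g(1) N by blast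
      from acts_at_translate[OF this inv[OF g(1)]] rep[OF g(2)] show ?thesis by blast
    next
      case 2
      hence "b \<in> grouplikes sc \<Delta>" using N by blast
      thus ?thesis by (simp add: acts_at_grouplike inv[OF 2])
    next
      case 3
      thus ?thesis by (simp add: acts_at_grouplike zero)
    qed
  qed
  hence "acts_at sc \<Delta> lam h k" for h k by (rule acts_at_left_from_basis[OF B])
  thus ?thesis by (simp add: partial_action_iff_acts_at one_on one)
qed

end
end

theorem theorem3p4:
  fixes sc :: "'k::field \<Rightarrow> 'a::ring_1 \<Rightarrow> 'a"
    and \<Delta> :: "'a \<Rightarrow> ('a \<times> 'a \<Rightarrow>\<^sub>0 'k) set"
    and \<epsilon> :: "'a \<Rightarrow> 'k"
    and S :: "'a \<Rightarrow> 'a"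
    and B' N Nt :: "'a set"
    and lam :: "'a \<Rightarrow> 'k"
  assumes hopf: "hopf_algebra sc \<Delta> \<epsilon> S"
    and disjoint: "grouplikes sc \<Delta> \<inter> B' = {}"
    and basis: "is_basis sc (grouplikes sc \<Delta> \<union> B')"
    and lam_linear: "Vector_Spaces.linear sc (*) lam"
    and N_def: "N = {g \<in> grouplikes sc \<Delta>. lam g = 1}"
    and Nt: "subgroup N (grouplike_group sc \<Delta>) \<Longrightarrow> is_transversal B' N Nt"
  shows "partial_action sc \<Delta> lam \<longleftrightarrow>
           subgroup N (grouplike_group sc \<Delta>) \<and>
           initial_condition sc \<Delta> B' N lam \<and>
           is_solution lam (reduced_system sc \<Delta> B' N Nt)"
proof -
  interpret hopf_algebra sc \<Delta> \<epsilon> S by (fact hopf)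
  show ?thesis
  proof (intro iffI conjI; (elim conjE)?)
    assume pa: "partial_action sc \<Delta> lam"
    show "subgroup N (grouplike_group sc \<Delta>)"
      by (rule partial_action_imp_subgroup[OF lam_linear pa N_def])
    show "initial_condition sc \<Delta> B' N lam"
      by (rule partial_action_imp_initial_condition[OF lam_linear pa N_def basis])
    show "is_solution lam (reduced_system sc \<Delta> B' N Nt)"
      using pa by (simp add: reduced_solution_iff[OF lam_linear basis]
                     partial_action_iff_acts_at[OF lam_linear])
  next
    assume "subgroup N (grouplike_group sc \<Delta>)" "initial_condition sc \<Delta> B' N lam"
      "is_solution lam (reduced_system sc \<Delta> B' N Nt)"
    thus "partial_action sc \<Delta> lam"
      by (intro partial_action_of_reduced_system[OF lam_linear _ _ _ basis Nt])
  qed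
qed

end
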